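(* Let $$\mathcal{A} = \left\{ f \in \mathcal{C}([0,+\infty)) \cap L^1([0,+\infty)) : \limsup_{x \to +\infty} |f(x)| = +\infty \right\}.$$ Then $\mathcal{A}$ is strongly algebrable; that is, there is an infinitely generated free (commutative) subalgebra $M$ of the algebra $\mathcal{C}([0,+\infty))$ with pointwise operations such that $M\setminus\{0\}\subset\mathcal{A}$.
   Context: $\mathcal{C}([0,+\infty))$ is the real algebra of all continuous functions $[0,+\infty)\to\mathbb{R}$ with pointwise operations, and $L^1([0,+\infty))$ is the space of Lebesgue integrable functions on $[0,+\infty)$. Subalgebras are not required to contain a unit. A subset $A$ of a commutative algebra is algebrable if there is an algebra $M$ with $M\setminus\{0\}\subset A$ that is infinitely generated (every system of generators of $M$ is infinite), and strongly algebrable if moreover $M$ can be taken free. Equivalently (in the commutative case), there is an infinite set $B$ generating the algebra $M$ such that for every $s\in\mathbb{N}$, every nonzero polynomial $P$ in $s$ variables without constant term and all distinct $f_1,\dots,f_s\in B$, one has $P(f_1,\dots,f_s)\in M\setminus\{0\}$, and $M\setminus\{0\}\subset A$. *)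

theory Defs
  imports "HOL-Analysis.Analysis" "HOL-Library.Poly_Mapping"
begin

section \<open>Algebrability in commutative real algebras\<close>

text \<open>Subalgebras are not required to contain the unit of the ambient algebra.\<close>

definition subalgebra :: "'a::{comm_ring_1, real_algebra_1} set \<Rightarrow> bool" where
  "subalgebra M \<longleftrightarrow> subspace M \<and> (\<forall>x\<in>M. \<forall>y\<in>M. x * y \<in> M)"

definition generates :: "'a::{comm_ring_1, real_algebra_1} set \<Rightarrow> 'a set \<Rightarrow> bool" where
  "generates B M \<longleftrightarrow> subalgebra hull B = M"

definition infinitely_generated :: "'a::{comm_ring_1, real_algebra_1} set \<Rightarrow> bool" where
  "infinitely_generated M \<longleftrightarrow> (\<forall>B. generates B M \<longrightarrow> infinite B)"

text \<open>
  Real polynomials in the variables \<open>X\<^sub>0, X\<^sub>1, \<dots>\<close> are finitely supported maps from monomials to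
  coefficients, a monomial being a finitely supported map from variable indices to exponents.
\<close>

type_synonym real_mpoly = "(nat \<Rightarrow>\<^sub>0 nat) \<Rightarrow>\<^sub>0 real"

definition in_vars :: "nat \<Rightarrow> real_mpoly \<Rightarrow> bool" where
  "in_vars s P \<longleftrightarrow> (\<forall>m\<in>Poly_Mapping.keys P. Poly_Mapping.keys m \<subseteq> {..<s})"

definition without_constant_term :: "real_mpoly \<Rightarrow> bool" where
  "without_constant_term P \<longleftrightarrow> Poly_Mapping.lookup P 0 = 0"

definition mpoly_eval :: "real_mpoly \<Rightarrow> (nat \<Rightarrow> 'a::{comm_ring_1, real_algebra_1}) \<Rightarrow> 'a" where
  "mpoly_eval P f =
     (\<Sum>m\<in>Poly_Mapping.keys P. Poly_Mapping.lookup P m *\<^sub>R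
        (\<Prod>i\<in>Poly_Mapping.keys m. f i ^ Poly_Mapping.lookup m i))"

text \<open>
  Freeness is meant in the category of commutative algebras without unit, whence the restriction to
  polynomials without constant term.
\<close>

definition free_generators :: "'a::{comm_ring_1, real_algebra_1} set \<Rightarrow> 'a set \<Rightarrow> bool" where
  "free_generators B M \<longleftrightarrow> generates B M \<and>
     (\<forall>s P f. P \<noteq> 0 \<and> in_vars s P \<and> without_constant_term P \<and>
        inj_on f {..<s} \<and> f ` {..<s} \<subseteq> B \<longrightarrow> mpoly_eval P f \<noteq> 0)"

definition free_algebra :: "'a::{comm_ring_1, real_algebra_1} set \<Rightarrow> bool" where
  "free_algebra M \<longleftrightarrow> (\<exists>B. free_generators B M)"

definition strongly_algebrable :: "'a::{comm_ring_1, real_algebra_1} set \<Rightarrow> bool" where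
  "strongly_algebrable A \<longleftrightarrow>
     (\<exists>M. subalgebra M \<and> infinitely_generated M \<and> free_algebra M \<and> M - {0} \<subseteq> A)"


section \<open>The algebra of continuous functions on the half-line\<close>

text \<open>
  A continuous function on \<open>[0, \<infinity>)\<close> is represented by its extension by zero to the real line, so
  that equality in the type is equality on the half-line; the extension may jump
  at \<open>0\<close>.
\<close>

typedef half_line_fun = "{f :: real \<Rightarrow> real. continuous_on {0..} f \<and> (\<forall>x<0. f x = 0)}"
  morphisms hl_apply Half_line_fun
  by (rule exI[of _ "\<lambda>_. 0"]) auto

setup_lifting type_definition_half_line_fun

instantiation half_line_fun :: comm_ring_1
begin

lift_definition zero_half_line_fun :: half_line_fun is "\<lambda>_. 0"
  by auto

lift_definition one_half_line_fun :: half_line_fun is "\<lambda>x. if 0 \<le> x then 1 else 0"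
  by (auto intro: continuous_on_eq[of _ "\<lambda>_. 1"])

lift_definition plus_half_line_fun :: "half_line_fun \<Rightarrow> half_line_fun \<Rightarrow> half_line_fun"
  is "\<lambda>f g x. f x + g x"
  by (auto intro: continuous_on_add)

lift_definition minus_half_line_fun :: "half_line_fun \<Rightarrow> half_line_fun \<Rightarrow> half_line_fun"
  is "\<lambda>f g x. f x - g x"
  by (auto intro: continuous_on_diff)

lift_definition uminus_half_line_fun :: "half_line_fun \<Rightarrow> half_line_fun"
  is "\<lambda>f x. - f x"
  by (auto intro: continuous_on_minus)

lift_definition times_half_line_fun :: "half_line_fun \<Rightarrow> half_line_fun \<Rightarrow> half_line_fun"
  is "\<lambda>f g x. f x * g x"
  by (auto intro: continuous_on_mult)

instance
proof
  show "(0 :: half_line_fun) \<noteq> 1"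
    by transfer (auto simp: fun_eq_iff intro!: exI[of _ 0])
qed (transfer; force simp: fun_eq_iff algebra_simps)+

end

instantiation half_line_fun :: real_algebra_1
begin

lift_definition scaleR_half_line_fun :: "real \<Rightarrow> half_line_fun \<Rightarrow> half_line_fun"
  is "\<lambda>c f x. c * f x"
  by (auto intro: continuous_on_mult_left)

instance
  by standard (transfer; force simp: fun_eq_iff algebra_simps)+

end

lemma ex1_half_line_fun:
  assumes "continuous_on {0..} (g :: real \<Rightarrow> real)"
  shows "\<exists>!f. \<forall>x\<ge>0. hl_apply f x = g x"
proof -
  have "continuous_on {0..} (\<lambda>x. if 0 \<le> x then g x else 0)"
    using assms by (rule continuous_on_eq) auto
  then have ex: "\<exists>f. \<forall>x\<ge>0. hl_apply f x = g x"
    by (intro exI[of _ "Half_line_fun (\<lambda>x. if 0 \<le> x then g x else 0)"])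
       (simp add: Half_line_fun_inverse)
  have "f = f'" if "\<forall>x\<ge>0. hl_apply f x = g x" "\<forall>x\<ge>0. hl_apply f' x = g x" for f f'
  proof -
    have "hl_apply f x = hl_apply f' x" for x
      using that hl_apply[of f] hl_apply[of f'] by (cases "0 \<le> x") auto
    then show ?thesis
      by (simp add: hl_apply_inject[symmetric] fun_eq_iff)
  qed
  with ex show ?thesis by blast
qed

end

theory Submission
  imports Defs "HOL-Computational_Algebra.Primes"
begin

text \<open>
  For a positive integer \<open>n\<close> put \<open>g\<^sub>n(x) = n\<^sup>x T(x)\<^bsup>\<Omega>(n)\<^esup>\<close>. Here \<open>T\<close> is continuous with values in
  \<open>[0, 1]\<close>, equal to 1 at every natural number and supported in intervals around the natural numbers
  whose lengths decay faster than any exponential, and \<open>\<Omega>(n)\<close> is the number of prime factors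
  of \<open>n\<close>, counted with multiplicity. Since \<open>\<Omega>\<close> turns products into sums, \<open>n \<mapsto> g\<^sub>n\<close> is completely
  multiplicative, and unique factorization says that the multiplicative monoid of positive
  integers is free commutative on the primes. So a polynomial without constant term in the \<open>g\<^sub>p\<close>,
  \<open>p\<close> prime, is nothing but a linear combination of the \<open>g\<^sub>n\<close> with \<open>n \<ge> 2\<close>, distinct monomials giving
  distinct \<open>n\<close>; these combinations form the algebra \<open>M\<close>.

  At a natural number \<open>j\<close> the combination \<open>\<Sum> c\<^sub>n g\<^sub>n\<close> takes the value \<open>\<Sum> c\<^sub>n n\<^sup>j\<close>, which is dominated by its
  largest base as \<open>j\<close> grows (\<open>exponential_sum_at_infinity\<close>). As all bases are at least 2, every
  nontrivial combination is unbounded, and in particular nonzero: this gives both the infinite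
  upper limit and the linear independence of the \<open>g\<^sub>n\<close>, hence freeness on the primes. Integrability
  is a statement about each \<open>g\<^sub>n\<close> separately, and holds because the spikes get narrow faster than
  \<open>n\<^sup>x\<close> grows (\<open>set_integrable_exp_spike\<close>).

  Finally, \<open>M\<close> is not finitely generated. Finitely many elements involve only finitely many \<open>g\<^sub>n\<close>; if
  \<open>q\<close> is a prime larger than all these \<open>n\<close>, they lie in the span of the \<open>g\<^sub>n\<close> with \<open>q\<close> not dividing \<open>n\<close>.
  This is a subalgebra because \<open>q\<close> is prime, and it omits \<open>g\<^sub>q\<close>.
\<close>

section \<open>Narrow spikes at the integers\<close>

text \<open>
  The factor \<open>exp (x\<^sup>2)\<close> makes the widths of the spikes decay faster than \<open>exp (- K j)\<close> for every \<open>K\<close>, so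
  that one function suits all growth rates \<open>n\<^sup>x\<close>.
\<close>

definition spike :: "real \<Rightarrow> real" where
  "spike x = max 0 (1 - exp (x\<^sup>2) * infdist x \<nat>)"

lemma continuous_on_spike [continuous_intros]: "continuous_on S spike"
  unfolding spike_def by (intro continuous_intros)

lemma spike_nonneg: "0 \<le> spike x"
  by (simp add: spike_def)

lemma spike_le_one: "spike x \<le> 1"
  by (simp add: spike_def infdist_nonneg)

lemma spike_of_nat [simp]: "spike (real j) = 1"
  by (simp add: spike_def)

text \<open>
  Being on a spike at \<open>x\<close> bounds the distance to some \<open>j\<close> by \<open>exp (- x\<^sup>2)\<close>. To sum over the spikes one
  needs a bound in \<open>j\<close>, and \<open>j \<le> x + 1\<close> gives \<open>j\<^sup>2 \<le> 2 x\<^sup>2 + 2\<close>, whence the constants.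
\<close>

lemma spike_support:
  assumes "0 \<le> x" "spike x \<noteq> 0"
  obtains j :: nat where "dist x (real j) < 1" "dist x (real j) < exp (1 - (real j)\<^sup>2 / 2)"
proof -
  from assms(2) have "exp (x\<^sup>2) * infdist x \<nat> < 1"
    by (auto simp: spike_def max_def split: if_splits)
  then have "infdist x \<nat> < exp (- x\<^sup>2)"
    by (simp add: exp_minus field_simps)
  then have "(INF a\<in>\<nat>. dist x a) < exp (- x\<^sup>2)"
    by (simp add: infdist_def)
  then obtain a where "a \<in> \<nat>" and a: "dist x a < exp (- x\<^sup>2)"
    by (subst (asm) cINF_less_iff) auto
  then obtain j :: nat where j: "a = real j"
    by (auto elim: Nats_cases)
  have near: "dist x (real j) < 1"
    using a j by (metis exp_le_one_iff neg_le_0_iff_le order_less_le_trans zero_le_power2)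
  then have "real j \<le> x + 1"
    by (simp add: dist_real_def)
  then have "(real j)\<^sup>2 \<le> (x + 1)\<^sup>2"
    by (simp add: power_mono)
  also have "\<dots> \<le> 2 * x\<^sup>2 + 2"
    using zero_le_power2[of "x - 1"] by (simp add: power2_eq_square algebra_simps)
  finally have "- x\<^sup>2 \<le> 1 - (real j)\<^sup>2 / 2"
    by simp
  then have "exp (- x\<^sup>2) \<le> exp (1 - (real j)\<^sup>2 / 2)"
    by simp
  with a[unfolded j] have "dist x (real j) < exp (1 - (real j)\<^sup>2 / 2)"
    by (rule order_less_le_trans)
  with near that show thesis by blast
qed

text \<open>
  Completing the square in \<open>(K + 1) j - j\<^sup>2 / 2\<close> leaves a geometric series with ratio \<open>exp (- 1)\<close>.
\<close>

lemma summable_exp_linear_minus_square: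
  "summable (\<lambda>j::nat. exp (K * real j - (real j)\<^sup>2 / 2))"
proof (rule summable_comparison_test')
  show "summable (\<lambda>j. exp ((K + 1)\<^sup>2 / 2) * exp (- 1 :: real) ^ j)"
    by (intro summable_mult summable_geometric) simp
  fix j :: nat
  have "K * real j - (real j)\<^sup>2 / 2 \<le> (K + 1)\<^sup>2 / 2 - real j"
    using zero_le_power2[of "real j - (K + 1)"] by (simp add: power2_eq_square field_simps)
  then have "exp (K * real j - (real j)\<^sup>2 / 2) \<le> exp ((K + 1)\<^sup>2 / 2 - real j)"
    by simp
  also have "\<dots> = exp ((K + 1)\<^sup>2 / 2) * exp (- real j)"
    by (simp flip: exp_add)
  also have "exp (- real j) = exp (- 1 :: real) ^ j"
    using exp_of_nat_mult[of j "- 1 :: real"] by simp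
  finally show "norm (exp (K * real j - (real j)\<^sup>2 / 2)) \<le> exp ((K + 1)\<^sup>2 / 2) * exp (- 1 :: real) ^ j"
    by simp
qed

text \<open>
  The function is dominated by a sum of constants on balls around the natural numbers: \<open>h j\<close> bounds
  it on the spike at \<open>j\<close> and \<open>w j\<close> is the radius of that spike, so its integral is at most
  \<open>\<Sum>j. 2 h(j) w(j)\<close>.
\<close>

lemma set_integrable_exp_spike:
  assumes "0 \<le> K"
  shows "set_integrable lborel {0..} (\<lambda>x. exp (K * x) * spike x)"
  unfolding set_integrable_def
proof (rule integrableI_bounded)
  define h where "h j = exp (K * (real j + 1))" for j :: nat
  define w where "w j = exp (1 - (real j)\<^sup>2 / 2)" for j :: nat
  show "(\<lambda>x. indicator {0..} x *\<^sub>R (exp (K * x) * spike x)) \<in> borel_measurable lborel"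
    using borel_measurable_continuous_on_indicator[of "{0..}" "\<lambda>x. exp (K * x) * spike x"]
    by (simp add: continuous_intros)
  have term_le: "u j \<le> suminf u" for u :: "nat \<Rightarrow> ennreal" and j
    using sum_le_suminf[of u "{j}"] by simp
  have bound: "ennreal (norm (indicator {0..} x *\<^sub>R (exp (K * x) * spike x)))
      \<le> suminf (\<lambda>j. ennreal (h j) * indicator (ball (real j) (w j)) x)" for x
  proof (cases "0 \<le> x \<and> spike x \<noteq> 0")
    case True
    then obtain j :: nat where j: "dist x (real j) < 1" "dist x (real j) < w j"
      unfolding w_def by (blast intro: spike_support)
    then have "x \<le> real j + 1"
      by (simp add: dist_real_def)
    then have "exp (K * x) * spike x \<le> h j * 1"
      unfolding h_def using assms
      by (intro mult_mono spike_le_one spike_nonneg) (auto intro: mult_left_mono)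
    then have "ennreal (norm (indicator {0..} x *\<^sub>R (exp (K * x) * spike x)))
        \<le> ennreal (h j) * indicator (ball (real j) (w j)) x"
      using j True by (simp add: dist_commute spike_nonneg abs_mult ennreal_leI)
    also have "\<dots> \<le> suminf (\<lambda>j. ennreal (h j) * indicator (ball (real j) (w j)) x)"
      by (rule term_le)
    finally show ?thesis .
  qed auto
  have [measurable]: "ball (real j) (w j) \<in> sets lborel" for j
    by (simp only: sets_lborel borel_open open_ball)
  have len: "emeasure lborel (ball (real j) (w j)) = ennreal (2 * w j)" for j
    by (simp add: ball_eq_greaterThanLessThan w_def)
  have summ: "summable (\<lambda>j. h j * (2 * w j))"
  proof -
    have "(\<lambda>j. h j * (2 * w j)) =
        (\<lambda>j. (2 * exp (K + 1)) * exp (K * real j - (real j)\<^sup>2 / 2))"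
      by (simp add: h_def w_def fun_eq_iff exp_add[symmetric] algebra_simps)
    then show ?thesis
      by (simp only: summable_mult summable_exp_linear_minus_square)
  qed
  have "(\<integral>\<^sup>+x. ennreal (norm (indicator {0..} x *\<^sub>R (exp (K * x) * spike x))) \<partial>lborel)
      \<le> (\<integral>\<^sup>+x. suminf (\<lambda>j. ennreal (h j) * indicator (ball (real j) (w j)) x) \<partial>lborel)"
    by (intro nn_integral_mono bound)
  also have "\<dots> = suminf (\<lambda>j. ennreal (h j) * ennreal (2 * w j))"
    by (simp add: nn_integral_suminf nn_integral_cmult_indicator len)
  also have "\<dots> = suminf (\<lambda>j. ennreal (h j * (2 * w j)))"
    by (simp add: ennreal_mult h_def w_def)
  also have "\<dots> = ennreal (suminf (\<lambda>j. h j * (2 * w j)))"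
    using summ by (intro suminf_ennreal2) (auto simp: h_def w_def)
  also have "\<dots> < \<infinity>"
    by simp
  finally show "(\<integral>\<^sup>+x. ennreal (norm (indicator {0..} x *\<^sub>R (exp (K * x) * spike x))) \<partial>lborel) < \<infinity>" .
qed

section \<open>A copy of the multiplicative monoid of positive integers\<close>

definition bigomega :: "nat \<Rightarrow> nat" where
  "bigomega n = size (prime_factorization n)"

lemma bigomega_mult: "m > 0 \<Longrightarrow> n > 0 \<Longrightarrow> bigomega (m * n) = bigomega m + bigomega n"
  by (simp add: bigomega_def prime_factorization_mult)

lemma bigomega_pos: "n \<ge> 2 \<Longrightarrow> bigomega n > 0"
  using prime_factorization_empty_iff[of n] by (auto simp: bigomega_def intro!: gr0I)

text \<open>
  The function \<open>n\<^sup>x T(x)\<^bsup>\<Omega>(n)\<^esup>\<close>. The exponent of \<open>T\<close> must be additive in \<open>n\<close> for the family to be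
  multiplicative, and it must be determined by \<open>n\<close>: otherwise there would be nonzero combinations
  that vanish at all natural numbers, such as \<open>2\<^sup>x T(x) - 2\<^sup>x T(x)\<^sup>2\<close>.
\<close>

lift_definition spiked_power :: "nat \<Rightarrow> half_line_fun" is
  "\<lambda>n x. if 0 \<le> x then exp (ln (real n) * x) * spike x ^ bigomega n else 0"
proof -
  fix n
  have "continuous_on {0..} (\<lambda>x. exp (ln (real n) * x) * spike x ^ bigomega n)"
    by (intro continuous_intros)
  then have "continuous_on {0..}
      (\<lambda>x. if 0 \<le> x then exp (ln (real n) * x) * spike x ^ bigomega n else 0)"
    by (rule continuous_on_eq) auto
  then show "continuous_on {0..} (\<lambda>x. if 0 \<le> x then exp (ln (real n) * x) * spike x ^ bigomega n else 0)
     \<and> (\<forall>x<0. (if 0 \<le> x then exp (ln (real n) * x) * spike x ^ bigomega n else 0) = 0)"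
    by simp
qed

lemma spiked_power_one: "spiked_power 1 = 1"
  by transfer (simp add: fun_eq_iff bigomega_def)

lemma spiked_power_mult:
  "m > 0 \<Longrightarrow> n > 0 \<Longrightarrow> spiked_power (m * n) = spiked_power m * spiked_power n"
  by transfer (auto simp: fun_eq_iff bigomega_mult ln_mult power_add exp_add algebra_simps)

lemma spiked_power_power: "n > 0 \<Longrightarrow> spiked_power (n ^ k) = spiked_power n ^ k"
  by (induction k) (simp_all add: spiked_power_one[simplified] spiked_power_mult)

lemma spiked_power_prod:
  "finite I \<Longrightarrow> (\<And>i. i \<in> I \<Longrightarrow> a i > 0) \<Longrightarrow> spiked_power (\<Prod>i\<in>I. a i) = (\<Prod>i\<in>I. spiked_power (a i))"
  by (induction I rule: finite_induct)
    (auto simp: spiked_power_one[simplified] spiked_power_mult prod_pos)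

lemma hl_apply_spiked_power_of_nat:
  "n > 0 \<Longrightarrow> hl_apply (spiked_power n) (real j) = real n ^ j"
  by transfer (simp add: mult.commute exp_of_nat_mult)

lemma inj_on_spiked_power: "inj_on spiked_power {2..}"
proof (rule inj_onI)
  fix m n :: nat
  assume "m \<in> {2..}" "n \<in> {2..}" "spiked_power m = spiked_power n"
  then show "m = n"
    using hl_apply_spiked_power_of_nat[of m 1] hl_apply_spiked_power_of_nat[of n 1] by simp
qed

lemma hl_apply_sum: "hl_apply (\<Sum>i\<in>I. f i) x = (\<Sum>i\<in>I. hl_apply (f i) x)"
  by (induction I rule: infinite_finite_induct)
    (simp_all add: zero_half_line_fun.rep_eq plus_half_line_fun.rep_eq)

lemma hl_apply_lincomb:
  "hl_apply (\<Sum>n\<in>F. c n *\<^sub>R spiked_power n) x = (\<Sum>n\<in>F. c n * hl_apply (spiked_power n) x)"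
  by (simp add: hl_apply_sum scaleR_half_line_fun.rep_eq)

section \<open>Integrability and growth\<close>

text \<open>
  For \<open>n \<ge> 2\<close> the exponent of the spike is positive, so the function is below \<open>n\<^sup>x T(x)\<close>; for \<open>n = 1\<close> it
  is the constant 1, and the claim fails.
\<close>

lemma set_integrable_spiked_power:
  assumes "n \<ge> 2"
  shows "set_integrable lebesgue {0..} (hl_apply (spiked_power n))"
proof -
  have cont: "continuous_on {0..} (hl_apply (spiked_power n))"
    using hl_apply[of "spiked_power n"] by simp
  have meas: "(\<lambda>x. indicator {0..} x *\<^sub>R hl_apply (spiked_power n) x) \<in> borel_measurable lborel"
    using borel_measurable_continuous_on_indicator[OF _ cont] by simp
  have "norm (hl_apply (spiked_power n) x) \<le> norm (exp (ln (real n) * x) * spike x)" if "0 \<le> x" for x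
  proof -
    have "spike x ^ bigomega n \<le> spike x ^ 1"
      using bigomega_pos[OF assms] by (intro power_decreasing spike_nonneg spike_le_one) auto
    with that show ?thesis
      by (simp add: spiked_power.rep_eq spike_nonneg abs_mult)
  qed
  then have le: "AE x in lborel. norm (indicator {0..} x *\<^sub>R hl_apply (spiked_power n) x)
      \<le> norm (indicator {0..} x *\<^sub>R (exp (ln (real n) * x) * spike x))"
    by (intro AE_I2) (simp add: indicator_def)
  have "integrable lborel (\<lambda>x. indicator {0..} x *\<^sub>R (exp (ln (real n) * x) * spike x))"
    using set_integrable_exp_spike[of "ln (real n)"] assms by (simp add: set_integrable_def)
  then have "integrable lborel (\<lambda>x. indicator {0..} x *\<^sub>R hl_apply (spiked_power n) x)"
    using meas le by (rule Bochner_Integration.integrable_bound)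
  with meas show ?thesis
    unfolding set_integrable_def by (simp add: integrable_completion)
qed

text \<open>
  Divide by \<open>N\<^sup>j\<close>, where \<open>N\<close> is the largest base with nonzero coefficient: what remains converges to
  that coefficient, while \<open>N\<^sup>j\<close> diverges since \<open>N \<ge> 2\<close>.
\<close>

lemma exponential_sum_at_infinity:
  fixes c :: "nat \<Rightarrow> real"
  assumes "finite F" "F \<subseteq> {2..}" "n \<in> F" "c n \<noteq> 0"
  shows "filterlim (\<lambda>j. \<bar>\<Sum>n\<in>F. c n * real n ^ j\<bar>) at_top sequentially"
proof -
  define G where "G = {n \<in> F. c n \<noteq> 0}"
  have G: "finite G" "G \<noteq> {}" "G \<subseteq> {2..}"
    using assms by (auto simp: G_def)
  define N where "N = Max G"
  have N: "N \<in> G" "\<And>n. n \<in> G \<Longrightarrow> n \<le> N"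
    using G by (auto simp: N_def)
  then have N2: "N \<ge> 2" "c N \<noteq> 0"
    using G by (auto simp: G_def)
  have sum_eq: "(\<Sum>n\<in>F. c n * real n ^ j) = real N ^ j * (\<Sum>n\<in>G. c n * (real n / real N) ^ j)" for j
  proof -
    have "(\<Sum>n\<in>F. c n * real n ^ j) = (\<Sum>n\<in>G. c n * real n ^ j)"
      using assms(1) by (intro sum.mono_neutral_right) (auto simp: G_def)
    also have "\<dots> = real N ^ j * (\<Sum>n\<in>G. c n * (real n / real N) ^ j)"
      using N2 by (simp add: sum_distrib_left power_divide)
    finally show ?thesis .
  qed
  have "(\<lambda>j. c n * (real n / real N) ^ j) \<longlonglongrightarrow> (if n = N then c N else 0)" if "n \<in> G" for n
  proof (cases "n = N")
    case False
    with N(2)[OF that] have "real n / real N < 1"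
      by simp
    then have "(\<lambda>j. c n * (real n / real N) ^ j) \<longlonglongrightarrow> c n * 0"
      by (intro tendsto_mult tendsto_const LIMSEQ_realpow_zero) auto
    with False show ?thesis by simp
  qed (use N2 in simp)
  then have "(\<lambda>j. \<Sum>n\<in>G. c n * (real n / real N) ^ j) \<longlonglongrightarrow> (\<Sum>n\<in>G. if n = N then c N else 0)"
    by (rule tendsto_sum)
  then have "(\<lambda>j. \<bar>\<Sum>n\<in>G. c n * (real n / real N) ^ j\<bar>) \<longlonglongrightarrow> \<bar>c N\<bar>"
    using G N by (intro tendsto_rabs) simp
  moreover have "filterlim (\<lambda>j. real N ^ j) at_top sequentially"
    using N2(1) by (intro filterlim_at_infinity_imp_filterlim_at_top filterlim_realpow_sequentially_gt1) auto
  ultimately have "filterlim (\<lambda>j. \<bar>\<Sum>n\<in>G. c n * (real n / real N) ^ j\<bar> * real N ^ j) at_top sequentially"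
    using N2 by (intro filterlim_tendsto_pos_mult_at_top) auto
  then show ?thesis
    by (simp add: sum_eq abs_mult mult.commute)
qed

lemma Limsup_eq_infinity_if_seq:
  fixes f :: "real \<Rightarrow> real"
  assumes "filterlim (\<lambda>j::nat. f (real j)) at_top sequentially"
  shows "Limsup at_top (\<lambda>x. ereal (f x)) = \<infinity>"
proof (rule ccontr)
  assume "Limsup at_top (\<lambda>x. ereal (f x)) \<noteq> \<infinity>"
  then have "Limsup at_top (\<lambda>x. ereal (f x)) < \<infinity>"
    by simp
  then obtain r :: real where "Limsup at_top (\<lambda>x. ereal (f x)) < ereal r"
    using less_PInf_Ex_of_nat by fastforce
  then have "\<forall>\<^sub>F x in at_top. ereal (f x) < ereal r"
    by (rule Limsup_lessD)
  then have "\<forall>\<^sub>F j in sequentially. f (real j) < r"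
    using eventually_compose_filterlim[OF _ filterlim_real_sequentially] by simp
  moreover have "\<forall>\<^sub>F j in sequentially. r \<le> f (real j)"
    using assms by (simp add: filterlim_at_top)
  ultimately have "\<forall>\<^sub>F j::nat in sequentially. False"
    by eventually_elim simp
  then show False by simp
qed

text \<open>
  The values at natural numbers already separate the spiked powers, since there the spike is 1 and
  only an exponential sum remains.
\<close>

lemma lincomb_spiked_power_neq_0:
  assumes "finite F" "F \<subseteq> {2..}" "n \<in> F" "c n \<noteq> 0"
  shows "(\<Sum>n\<in>F. c n *\<^sub>R spiked_power n) \<noteq> 0"
proof
  assume eq: "(\<Sum>n\<in>F. c n *\<^sub>R spiked_power n) = 0"
  have "(\<Sum>n\<in>F. c n * real n ^ j) = 0" for j
  proof -
    have "(\<Sum>n\<in>F. c n * real n ^ j) = hl_apply (\<Sum>n\<in>F. c n *\<^sub>R spiked_power n) (real j)"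
      unfolding hl_apply_lincomb using assms(2)
      by (intro sum.cong refl) (auto simp: hl_apply_spiked_power_of_nat)
    then show ?thesis
      by (simp add: eq zero_half_line_fun.rep_eq)
  qed
  moreover have "filterlim (\<lambda>j. \<bar>\<Sum>n\<in>F. c n * real n ^ j\<bar>) at_top sequentially"
    using assms by (rule exponential_sum_at_infinity)
  ultimately show False
    by (simp add: filterlim_at_top) (metis gt_ex not_le)
qed

text \<open>
  Injectivity allows linear combinations to be indexed by integers instead of by functions.
\<close>

lemma span_spiked_power_explicit:
  assumes "f \<in> span (spiked_power ` X)" "X \<subseteq> {2..}"
  obtains F c where "finite F" "F \<subseteq> X" "f = (\<Sum>n\<in>F. c n *\<^sub>R spiked_power n)"
proof -
  from assms(1) obtain t r where t: "finite t" "t \<subseteq> spiked_power ` X" "f = (\<Sum>a\<in>t. r a *\<^sub>R a)"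
    by (auto simp: span_explicit)
  from t(1,2) obtain F where F: "F \<subseteq> X" "finite F" "t = spiked_power ` F"
    by (meson finite_subset_image)
  have "inj_on spiked_power F"
    using inj_on_spiked_power F(1) assms(2) by (meson inj_on_subset)
  then have "f = (\<Sum>n\<in>F. r (spiked_power n) *\<^sub>R spiked_power n)"
    using t(3) F(3) by (simp add: sum.reindex)
  with F(2,1) show thesis by (rule that)
qed

lemma spiked_power_in_span_iff:
  assumes "X \<subseteq> {2..}" "n \<ge> 2"
  shows "spiked_power n \<in> span (spiked_power ` X) \<longleftrightarrow> n \<in> X"
proof
  assume "spiked_power n \<in> span (spiked_power ` X)"
  then obtain F c where F: "finite F" "F \<subseteq> X" "spiked_power n = (\<Sum>n\<in>F. c n *\<^sub>R spiked_power n)"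
    using assms(1) by (rule span_spiked_power_explicit)
  show "n \<in> X"
  proof (rule ccontr)
    assume "n \<notin> X"
    with F(2) have "n \<notin> F" by blast
    \<comment> \<open>Moving \<open>spiked_power n\<close> to the other side would give a nontrivial vanishing combination.\<close>
    let ?d = "\<lambda>k. if k = n then - 1 else c k"
    have "(\<Sum>k\<in>insert n F. ?d k *\<^sub>R spiked_power k) = - spiked_power n + (\<Sum>k\<in>F. ?d k *\<^sub>R spiked_power k)"
      using F(1) \<open>n \<notin> F\<close> by simp
    also have "(\<Sum>k\<in>F. ?d k *\<^sub>R spiked_power k) = spiked_power n"
      unfolding F(3) using \<open>n \<notin> F\<close> by (intro sum.cong) auto
    finally have "(\<Sum>k\<in>insert n F. ?d k *\<^sub>R spiked_power k) = 0"
      by simp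
    moreover have "(\<Sum>k\<in>insert n F. ?d k *\<^sub>R spiked_power k) \<noteq> 0"
      using F(1,2) assms by (intro lincomb_spiked_power_neq_0[of _ n]) auto
    ultimately show False by contradiction
  qed
qed (auto intro: span_base)

lemma span_spiked_power_integrable_unbounded:
  assumes "f \<in> span (spiked_power ` {2..})" "f \<noteq> 0"
  shows "set_integrable lebesgue {0..} (hl_apply f)"
    and "Limsup at_top (\<lambda>x. ereal \<bar>hl_apply f x\<bar>) = \<infinity>"
proof -
  from assms(1) obtain F c
    where F: "finite F" "F \<subseteq> {2..}" and f: "f = (\<Sum>n\<in>F. c n *\<^sub>R spiked_power n)"
    using order_refl by (rule span_spiked_power_explicit)
  have "set_integrable lebesgue {0..} (\<lambda>x. \<Sum>n\<in>F. c n * hl_apply (spiked_power n) x)"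
    using F by (intro absolutely_integrable_sum set_integrable_mult_right set_integrable_spiked_power) auto
  moreover have "hl_apply f = (\<lambda>x. \<Sum>n\<in>F. c n * hl_apply (spiked_power n) x)"
    by (rule ext) (simp only: f hl_apply_lincomb)
  ultimately show "set_integrable lebesgue {0..} (hl_apply f)"
    by simp
  have "\<exists>n\<in>F. c n \<noteq> 0"
    using assms(2) by (auto simp: f intro: ccontr)
  then obtain n where "n \<in> F" "c n \<noteq> 0" by blast
  with F have "filterlim (\<lambda>j. \<bar>\<Sum>n\<in>F. c n * real n ^ j\<bar>) at_top sequentially"
    by (intro exponential_sum_at_infinity[where n = n])
  moreover have "(\<Sum>n\<in>F. c n * real n ^ j) = hl_apply f (real j)" for j
    unfolding f hl_apply_lincomb using F(2)
    by (intro sum.cong refl) (auto simp: hl_apply_spiked_power_of_nat)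
  ultimately show "Limsup at_top (\<lambda>x. ereal \<bar>hl_apply f x\<bar>) = \<infinity>"
    by (intro Limsup_eq_infinity_if_seq) simp
qed

section \<open>Subalgebras spanned by spiked powers\<close>

lemma subalgebra_span:
  fixes S :: "'a::{comm_ring_1, real_algebra_1} set"
  assumes "\<And>a b. a \<in> S \<Longrightarrow> b \<in> S \<Longrightarrow> a * b \<in> S"
  shows "subalgebra (span S)"
proof -
  have left: "a * y \<in> span S" if "a \<in> S" "y \<in> span S" for a y
    using that(2)
  proof (induction y rule: span_induct_alt)
    case (step c x y)
    with assms[OF that(1)] show ?case
      by (simp add: distrib_left span_add span_scale span_base)
  qed (simp add: span_zero)
  have "x * y \<in> span S" if "x \<in> span S" "y \<in> span S" for x y
    using that(1)
  proof (induction x rule: span_induct_alt)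
    case (step c a x)
    with left that(2) show ?case
      by (simp add: distrib_right span_add span_scale)
  qed (simp add: span_zero)
  then show ?thesis
    by (simp add: subalgebra_def)
qed

lemma subalgebra_span_mult_closed:
  assumes "0 \<notin> X" "\<And>m n. m \<in> X \<Longrightarrow> n \<in> X \<Longrightarrow> m * n \<in> X"
  shows "subalgebra (span (spiked_power ` X))"
proof (rule subalgebra_span)
  fix a b
  assume "a \<in> spiked_power ` X" "b \<in> spiked_power ` X"
  then obtain m n where mn: "m \<in> X" "n \<in> X" and eq: "a = spiked_power m" "b = spiked_power n"
    by blast
  then have "a * b = spiked_power (m * n)"
    using assms(1) by (subst spiked_power_mult) (auto intro!: gr0I)
  with mn assms(2) show "a * b \<in> spiked_power ` X" by blast
qed

lemma subalgebra_spiked_powers: "subalgebra (span (spiked_power ` {2..}))"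
proof (rule subalgebra_span_mult_closed)
  fix m n :: nat
  assume "m \<in> {2..}" "n \<in> {2..}"
  then have "2 * 1 \<le> m * n"
    by (intro mult_le_mono) auto
  then show "m * n \<in> {2..}" by simp
qed simp

text \<open>
  By existence of prime factorizations, every \<open>spiked_power n\<close> with \<open>n \<ge> 2\<close> is a nonempty product of
  spiked powers of primes.
\<close>

lemma generates_spiked_primes:
  "generates (spiked_power ` {p. prime p}) (span (spiked_power ` {2..}))"
  unfolding generates_def
proof (rule hull_unique)
  show "spiked_power ` {p. prime p} \<subseteq> span (spiked_power ` {2..})"
    by (auto intro!: span_base prime_ge_2_nat)
  show "subalgebra (span (spiked_power ` {2..}))"
    by (rule subalgebra_spiked_powers)
next
  fix S
  assume primes: "spiked_power ` {p. prime p} \<subseteq> S" and S: "subalgebra S"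
  have "n \<ge> 2 \<longrightarrow> spiked_power n \<in> S" for n
  proof (induction n rule: prime_divisors_induct)
    case (factor p n)
    then have p: "spiked_power p \<in> S" "p > 0"
      using primes by (auto intro: prime_gt_0_nat)
    consider "n = 0" | "n = 1" | "n \<ge> 2" by linarith
    then show ?case
    proof cases
      case 3
      with factor p S show ?thesis
        by (simp add: spiked_power_mult subalgebra_def)
    qed (use p in auto)
  qed auto
  then show "span (spiked_power ` {2..}) \<subseteq> S"
    using S by (intro span_minimal) (auto simp: subalgebra_def)
qed

text \<open>
  Every finite subset is contained in the proper subalgebra spanned by the \<open>spiked_power n\<close> with
  \<open>q\<close> not dividing \<open>n\<close>, for a sufficiently large prime \<open>q\<close>.
\<close>

lemma infinitely_generated_spiked_powers:
  "infinitely_generated (span (spiked_power ` {2..}))"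
  unfolding infinitely_generated_def
proof (intro allI impI notI)
  fix B
  assume "generates B (span (spiked_power ` {2..}))" and "finite B"
  then have hull: "subalgebra hull B = span (spiked_power ` {2..})"
    by (simp add: generates_def)
  then have "B \<subseteq> span (spiked_power ` {2..})"
    using hull_subset by metis
  have "\<exists>F. finite F \<and> F \<subseteq> {2..} \<and> b \<in> span (spiked_power ` F)" if "b \<in> B" for b
  proof -
    have "b \<in> span (spiked_power ` {2..})"
      using that \<open>B \<subseteq> _\<close> by blast
    then obtain F c where F: "finite F" "F \<subseteq> {2..}" "b = (\<Sum>n\<in>F. c n *\<^sub>R spiked_power n)"
      using order_refl by (rule span_spiked_power_explicit)
    have "b \<in> span (spiked_power ` F)"
      unfolding F(3) by (intro span_sum span_scale span_base imageI)
    with F(1,2) show ?thesis by blast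
  qed
  then obtain F where F: "\<And>b. b \<in> B \<Longrightarrow> finite (F b) \<and> F b \<subseteq> {2..} \<and> b \<in> span (spiked_power ` F b)"
    by metis
  \<comment> \<open>Inserting 1 only serves to make the maximum meaningful when no integers occur.\<close>
  obtain q where q: "prime q" "Max (insert 1 (\<Union>(F ` B))) < q"
    using bigger_prime by blast
  define X where "X = {n::nat. n \<ge> 2 \<and> \<not> q dvd n}"
  have "F b \<subseteq> X" if "b \<in> B" for b
  proof
    fix n
    assume n: "n \<in> F b"
    have "n \<le> Max (insert 1 (\<Union>(F ` B)))"
      using F \<open>finite B\<close> n that by (intro Max_ge) auto
    with q have "n < q" by simp
    moreover have "n \<ge> 2"
      using F that n by auto
    ultimately show "n \<in> X"
      by (auto simp: X_def dest: dvd_imp_le)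
  qed
  then have "B \<subseteq> span (spiked_power ` X)"
    using F by (meson image_mono in_mono span_mono subsetI)
  moreover have "subalgebra (span (spiked_power ` X))"
  proof (rule subalgebra_span_mult_closed)
    fix m n
    assume mn: "m \<in> X" "n \<in> X"
    then have "2 * 1 \<le> m * n"
      by (intro mult_le_mono) (auto simp: X_def)
    with mn q(1) show "m * n \<in> X"
      by (auto simp: X_def prime_dvd_mult_iff)
  qed (simp add: X_def)
  ultimately have "span (spiked_power ` {2..}) \<subseteq> span (spiked_power ` X)"
    unfolding hull[symmetric] by (rule hull_minimal)
  moreover have "spiked_power q \<in> span (spiked_power ` {2..})"
    using q(1) by (auto intro!: span_base prime_ge_2_nat)
  ultimately have "q \<in> X"
    using spiked_power_in_span_iff[of X q] q(1) by (auto simp: X_def prime_ge_2_nat)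
  then show False by (simp add: X_def)
qed

section \<open>Freeness over the primes\<close>

text \<open>
  When the \<open>p i\<close> are distinct primes, this is a Goedel numbering of the monomials: the exponents of
  \<open>m\<close> can be read off from the prime factorization.
\<close>

definition monomial_value :: "(nat \<Rightarrow> nat) \<Rightarrow> (nat \<Rightarrow>\<^sub>0 nat) \<Rightarrow> nat" where
  "monomial_value p m = (\<Prod>i\<in>Poly_Mapping.keys m. p i ^ Poly_Mapping.lookup m i)"

lemma monomial_value_multiplicity:
  assumes p: "inj_on p {..<s}" "\<And>i. i < s \<Longrightarrow> prime (p i)"
    and m: "Poly_Mapping.keys m \<subseteq> {..<s}" and "i < s"
  shows "multiplicity (p i) (monomial_value p m) = Poly_Mapping.lookup m i"
proof -
  \<comment> \<open>The exponents as a function of the prime, to read the product as a prime factorization.\<close>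
  define e where "e q = Poly_Mapping.lookup m (the_inv_into {..<s} p q)" for q
  have "monomial_value p m = (\<Prod>i<s. p i ^ Poly_Mapping.lookup m i)"
    unfolding monomial_value_def using m
    by (intro prod.mono_neutral_left) (auto simp: in_keys_iff)
  also have "\<dots> = (\<Prod>i<s. p i ^ e (p i))"
    using p(1) by (intro prod.cong) (auto simp: e_def the_inv_into_f_f)
  also have "\<dots> = (\<Prod>q\<in>p ` {..<s}. q ^ e q)"
    using p(1) by (simp add: prod.reindex)
  also have "multiplicity (p i) \<dots> = e (p i)"
    using p(2) \<open>i < s\<close> by (subst multiplicity_prod_prime_powers) auto
  finally have "multiplicity (p i) (monomial_value p m) = e (p i)" .
  then show ?thesis
    using p(1) \<open>i < s\<close> by (simp add: e_def the_inv_into_f_f)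
qed

lemma inj_on_monomial_value:
  assumes p: "inj_on p {..<s}" "\<And>i. i < s \<Longrightarrow> prime (p i)"
  shows "inj_on (monomial_value p) {m. Poly_Mapping.keys m \<subseteq> {..<s}}"
proof (rule inj_onI)
  fix m m'
  assume mm: "m \<in> {m. Poly_Mapping.keys m \<subseteq> {..<s}}" "m' \<in> {m. Poly_Mapping.keys m \<subseteq> {..<s}}"
    and eq: "monomial_value p m = monomial_value p m'"
  have "Poly_Mapping.lookup m i = Poly_Mapping.lookup m' i" for i
  proof (cases "i < s")
    case True
    then show ?thesis
      using monomial_value_multiplicity[OF p] mm eq by (metis mem_Collect_eq)
  next
    case False
    then have "i \<notin> Poly_Mapping.keys m" "i \<notin> Poly_Mapping.keys m'"
      using mm by auto
    then show ?thesis by (simp add: in_keys_iff)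
  qed
  then show "m = m'"
    by (rule poly_mapping_eqI)
qed

text \<open>
  By multiplicativity the value of a monomial is the spiked power at its encoding, and distinct
  monomials have distinct encodings, so the coefficients of \<open>P\<close> are those of a linear combination
  of spiked powers. The absence of a constant term keeps the encodings away from 1.
\<close>

lemma mpoly_eval_spiked_primes_neq_0:
  assumes p: "inj_on p {..<s}" "\<And>i. i < s \<Longrightarrow> prime (p i)"
    and f: "\<And>i. i < s \<Longrightarrow> f i = spiked_power (p i)"
    and P: "P \<noteq> 0" "in_vars s P" "without_constant_term P"
  shows "mpoly_eval P f \<noteq> 0"
proof -
  let ?K = "Poly_Mapping.keys P" and ?v = "monomial_value p"
  have K: "Poly_Mapping.keys m \<subseteq> {..<s}" if "m \<in> ?K" for m
    using P(2) that by (simp add: in_vars_def)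
  have inj: "inj_on ?v ?K"
    using inj_on_monomial_value[OF p] K by (auto intro: inj_on_subset)
  have pos: "p i > 0" if "i < s" for i
    using p(2)[OF that] by (rule prime_gt_0_nat)
  have ge2: "?v m \<ge> 2" if m: "m \<in> ?K" for m
  proof -
    have "m \<noteq> 0"
      using P(3) m by (auto simp: without_constant_term_def in_keys_iff)
    then have "?v m \<noteq> ?v 0"
      using inj_on_monomial_value[OF p] K[OF m] by (auto dest: inj_onD)
    then have "?v m \<noteq> 1"
      by (simp add: monomial_value_def)
    moreover have "?v m > 0"
      unfolding monomial_value_def using K[OF m] pos by (intro prod_pos) auto
    ultimately show ?thesis by simp
  qed
  have mono: "(\<Prod>i\<in>Poly_Mapping.keys m. f i ^ Poly_Mapping.lookup m i) = spiked_power (?v m)"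
    if "m \<in> ?K" for m
  proof -
    have "spiked_power (?v m) = (\<Prod>i\<in>Poly_Mapping.keys m. spiked_power (p i ^ Poly_Mapping.lookup m i))"
      unfolding monomial_value_def using K[OF that] pos by (intro spiked_power_prod) auto
    also have "\<dots> = (\<Prod>i\<in>Poly_Mapping.keys m. f i ^ Poly_Mapping.lookup m i)"
      using K[OF that] f pos by (intro prod.cong) (auto simp: spiked_power_power)
    finally show ?thesis by simp
  qed
  \<comment> \<open>The coefficients of \<open>P\<close>, reindexed by the encodings of the monomials.\<close>
  define c where "c n = Poly_Mapping.lookup P (the_inv_into ?K ?v n)" for n
  have c: "c (?v m) = Poly_Mapping.lookup P m" if "m \<in> ?K" for m
    using that inj by (simp add: c_def the_inv_into_f_f)
  have "mpoly_eval P f = (\<Sum>m\<in>?K. c (?v m) *\<^sub>R spiked_power (?v m))"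
    unfolding mpoly_eval_def using mono c by (intro sum.cong) auto
  also have "\<dots> = (\<Sum>n\<in>?v ` ?K. c n *\<^sub>R spiked_power n)"
    using inj by (simp add: sum.reindex)
  also have "\<dots> \<noteq> 0"
  proof -
    obtain m where "m \<in> ?K"
      using P(1) by (metis ex_in_conv keys_eq_empty)
    then show ?thesis
      using ge2 c by (intro lincomb_spiked_power_neq_0[of _ "?v m"]) (auto simp: in_keys_iff)
  qed
  finally show ?thesis .
qed

lemma free_generators_spiked_primes:
  "free_generators (spiked_power ` {p. prime p}) (span (spiked_power ` {2..}))"
  unfolding free_generators_def
proof (intro conjI allI impI)
  fix s P f
  assume *: "P \<noteq> 0 \<and> in_vars s P \<and> without_constant_term P \<and> inj_on f {..<s} \<and>
    f ` {..<s} \<subseteq> spiked_power ` {p. prime p}"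
  then have "\<forall>i\<in>{..<s}. \<exists>p. prime p \<and> f i = spiked_power p"
    by auto
  then obtain p where p: "\<And>i. i < s \<Longrightarrow> prime (p i)" "\<And>i. i < s \<Longrightarrow> f i = spiked_power (p i)"
    by (metis lessThan_iff)
  have "inj_on p {..<s}"
  proof (rule inj_onI)
    fix i j
    assume "i \<in> {..<s}" "j \<in> {..<s}" "p i = p j"
    moreover from this have "f i = f j" using p by simp
    ultimately show "i = j" using * by (auto dest: inj_onD)
  qed
  with p * show "mpoly_eval P f \<noteq> 0"
    by (intro mpoly_eval_spiked_primes_neq_0) auto
qed (rule generates_spiked_primes)

theorem theorem2p6:
  shows "strongly_algebrable
    {f :: half_line_fun. set_integrable lebesgue {0..} (hl_apply f) \<and>
       Limsup at_top (\<lambda>x. ereal \<bar>hl_apply f x\<bar>) = \<infinity>}"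
  unfolding strongly_algebrable_def
proof (intro exI[of _ "span (spiked_power ` {2..})"] conjI)
  show "subalgebra (span (spiked_power ` {2..}))"
    by (rule subalgebra_spiked_powers)
  show "infinitely_generated (span (spiked_power ` {2..}))"
    by (rule infinitely_generated_spiked_powers)
  show "free_algebra (span (spiked_power ` {2..}))"
    unfolding free_algebra_def by (blast intro: free_generators_spiked_primes)
qed (use span_spiked_power_integrable_unbounded in auto)

end
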